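(* Consider the two-stage stochastic lot-sizing problem SLSCC (defined in the context) and suppose that the stronger Wagner–Whitin condition holds: $\alpha_i+h_i\ge\alpha_{i+1}$ for $i=1,\dots,p$, and $\alpha_i+(1-\varepsilon)h_i\ge\alpha_{i+1}$ for $i=p+1,\dots,T-1$. Then there exists an optimal solution $(x,y,s,(s_{ji}),z)$ of SLSCC whose production and inventory levels have the following form, with $\psi,\phi,J_z$ defined from this solution: (a) if $x_i>0$, then $$x_i=\begin{cases}\sum_{t=i}^{\psi(i)-1}d_t, & \psi(i)\le p,\\ \sum_{t=i}^{p}d_t+\max_{\tau\in J_z}\Big\{\sum_{t=p+1}^{\psi(i)-1}d_{\tau t}\Big\}, & i\le p,\ \psi(i)\ge p+1,\\ \max_{\tau\in J_z}\Big\{\sum_{t=i}^{\psi(i)-1}d_{\tau t}-s_{\tau(i-1)}\Big\}, & i\ge p+1;\end{cases}$$ (b) for the first-stage inventory levels, $$s_i=\begin{cases}\sum_{t=i+1}^{\psi(i)-1}d_t, & \psi(i)\le p,\\ \sum_{t=i+1}^{p}d_t+\max_{\tau\in J_z}\Big\{\sum_{t=p+1}^{\psi(i)-1}d_{\tau t}\Big\}, & i\le p,\ \psi(i)\ge p+1;\end{cases}$$ (c) if $z_j=0$, then $$s_{ji}=\begin{cases}\max_{\tau\in J_z}\Big\{\sum_{t=p+1}^{\psi(i)-1}d_{\tau t}\Big\}-\sum_{t=p+1}^{i}d_{jt}, & \phi(i)\le p,\ i\ge p+1,\\ x_i+s_{j(i-1)}-d_{ji}, & y_i=1,\ i\ge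 p+1,\\ x_{\phi(i)}+s_{j(\phi(i)-1)}-\sum_{t=\phi(i)}^{i}d_{jt}, & y_i=0,\ \phi(i)\ge p+1;\end{cases}$$ (d) if $z_j=1$, then $s_{ji}=0$ for $i\in[p+1,T]$.
   Context: For integers $a\le b$, $[a,b]=\{a,a+1,\dots,b\}$; empty sums are $0$. Problem SLSCC. Data: horizon length $T$, $N=\{1,\dots,T\}$, a period $p\in N$ (first stage: periods $1,\dots,p$, with deterministic demands; second stage: periods $p+1,\dots,T$, with random demands); a finite scenario set $\Omega=\{1,\dots,m\}$, where scenario $j$ has probability $p_j$; a given risk threshold $\varepsilon$; first-stage demands $d_i$ ($i\in[1,p]$); second-stage demands $d_{ji}$ in period $i\in[p+1,T]$ under scenario $j\in\Omega$; unit production costs $\alpha_i$, setup costs $\beta_i$, unit holding costs $h_i$ ($i\in N$), the second-stage holding costs $h_i$, $i\in[p+1,T]$, being nonnegative. Constants: $M_i=\sum_{t=i}^{p}d_t+\max_{j\in\Omega}\sum_{t=p+1}^{T}d_{jt}$ for $i\in[1,p]$ and $M_i=\max_{j\in\Omega}\sum_{t=i}^{T}d_{jt}$ for $i\in[p+1,T]$. SLSCC is the problem $$\min\ \sum_{i=1}^{p}(\alpha_ix_i+\beta_iy_i+h_is_i)+\sum_{i=p+1}^{T}(\alpha_ix_i+\beta_iy_i)+\sum_{j=1}^{m}p_j\sum_{i=p+1}^{T}h_is_{ji}$$ subject to - $x_i+s_{i-1}=d_i+s_i$, $i\in[1,p]$ (with $s_0=0$); - $s_p+\sum_{i=p+1}^{t}x_i\ge\sum_{i=p+1}^{t}d_{ji}(1-z_j)$,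 $t\in[p+1,T]$, $j\in\Omega$; - $\sum_{j=1}^{m}p_jz_j\le\varepsilon$; - $s_{ji}\ge\big[\sum_{t=p+1}^{i}(x_t-d_{jt})+s_p\big](1-z_j)$, $i\in[p+1,T]$, $j\in\Omega$; - $x_i\le M_iy_i$, $i\in N$; - $x_i\ge0$ ($i\in N$), $s_i\ge0$ ($i\in[1,p]$), $s_{ji}\ge0$ ($i\in[p+1,T]$, $j\in\Omega$), $y_i\in\{0,1\}$ ($i\in N$), $z_j\in\{0,1\}$ ($j\in\Omega$). Conventions: $s_{jp}:=s_p$ for all $j\in\Omega$; $y_{T+1}=1$ and $\alpha_{T+1}=0$. Given $y$ and $z$: $\psi(i)$ is the earliest period after $i$ that is set up, i.e. $\psi(i)=\min\{k\ge i+1:y_k=1\}$ (so $\psi(i)=T+1$ if no period in $[i+1,T]$ is set up); $\phi(i)=\max\{k\in[1,i-1]:y_k=1\}$ is the latest period before $i$ that is set up; $J_z=\{j\in\Omega:z_j=0\}$.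
   Formalization: Demands are taken to be nonnegative, and if p<T the second Wagner–Whitin condition is also assumed at i=T, i.e. α_T+(1−ε)h_T ≥ α_{T+1} = 0; without these the claim fails (e.g. p=1, T=2, unit demands, h=β=0, ε=0, α_1=α_2=−100). *)

theory Defs
  imports Complex_Main
begin

(* Periods are 1..horizon and scenarios 1..nscen; the values of the function-valued fields
   outside the relevant index ranges are never used. *)
record slscc =
  horizon :: nat                     (* T *)
  stage :: nat                       (* p, the last first-stage period *)
  nscen :: nat                       (* m *)
  prb :: "nat \<Rightarrow> real"               (* p_j *)
  risk :: real                       (* epsilon *)
  dem :: "nat \<Rightarrow> real"               (* d_i, first stage *)
  sdem :: "nat \<Rightarrow> nat \<Rightarrow> real"       (* d_{ji}: scenario j first, then period i *)
  alpha :: "nat \<Rightarrow> real"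
  beta :: "nat \<Rightarrow> real"
  hold :: "nat \<Rightarrow> real"              (* h_i *)

record slscc_sol =
  xx :: "nat \<Rightarrow> real"
  yy :: "nat \<Rightarrow> real"
  inv1 :: "nat \<Rightarrow> real"              (* s_i, 0 <= i <= p *)
  inv2 :: "nat \<Rightarrow> nat \<Rightarrow> real"       (* s_{ji}, i > p *)
  zz :: "nat \<Rightarrow> real"

abbreviation scenarios :: "slscc \<Rightarrow> nat set" where
  "scenarios I \<equiv> {1..nscen I}"

text \<open>Demands are nonnegative, as usual in lot-sizing. Of the costs, only the second-stage
  holding costs carry a sign condition.\<close>

definition slscc_data :: "slscc \<Rightarrow> bool" where
  "slscc_data I \<longleftrightarrow>
     1 \<le> stage I \<and> stage I \<le> horizon I \<and>
     (\<forall>j\<in>scenarios I. 0 \<le> prb I j) \<and> (\<Sum>j\<in>scenarios I. prb I j) = 1 \<and>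
     0 \<le> risk I \<and>
     (\<forall>i\<in>{1..stage I}. 0 \<le> dem I i) \<and>
     (\<forall>j\<in>scenarios I. \<forall>i\<in>{stage I + 1..horizon I}. 0 \<le> sdem I j i) \<and>
     (\<forall>i\<in>{stage I + 1..horizon I}. 0 \<le> hold I i)"

definition bigM :: "slscc \<Rightarrow> nat \<Rightarrow> real" where
  "bigM I i =
     (if i \<le> stage I
      then (\<Sum>t=i..stage I. dem I t)
           + (MAX j\<in>scenarios I. \<Sum>t=stage I + 1..horizon I. sdem I j t)
      else (MAX j\<in>scenarios I. \<Sum>t=i..horizon I. sdem I j t))"

definition slscc_cost :: "slscc \<Rightarrow> slscc_sol \<Rightarrow> real" where
  "slscc_cost I S =
     (\<Sum>i=1..stage I. alpha I i * xx S i + beta I i * yy S i + hold I i * inv1 S i)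
     + (\<Sum>i=stage I + 1..horizon I. alpha I i * xx S i + beta I i * yy S i)
     + (\<Sum>j\<in>scenarios I. prb I j * (\<Sum>i=stage I + 1..horizon I. hold I i * inv2 S j i))"

definition slscc_feasible :: "slscc \<Rightarrow> slscc_sol \<Rightarrow> bool" where
  "slscc_feasible I S \<longleftrightarrow>
     inv1 S 0 = 0 \<and>
     (\<forall>i\<in>{1..stage I}. xx S i + inv1 S (i - 1) = dem I i + inv1 S i) \<and>
     (\<forall>t\<in>{stage I + 1..horizon I}. \<forall>j\<in>scenarios I.
        inv1 S (stage I) + (\<Sum>i=stage I + 1..t. xx S i)
          \<ge> (\<Sum>i=stage I + 1..t. sdem I j i * (1 - zz S j))) \<and>
     (\<Sum>j\<in>scenarios I. prb I j * zz S j) \<le> risk I \<and>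
     (\<forall>i\<in>{stage I + 1..horizon I}. \<forall>j\<in>scenarios I.
        inv2 S j i
          \<ge> ((\<Sum>t=stage I + 1..i. xx S t - sdem I j t) + inv1 S (stage I)) * (1 - zz S j)) \<and>
     (\<forall>i\<in>{1..horizon I}. xx S i \<le> bigM I i * yy S i) \<and>
     (\<forall>i\<in>{1..horizon I}. 0 \<le> xx S i) \<and>
     (\<forall>i\<in>{1..stage I}. 0 \<le> inv1 S i) \<and>
     (\<forall>i\<in>{stage I + 1..horizon I}. \<forall>j\<in>scenarios I. 0 \<le> inv2 S j i) \<and>
     (\<forall>i\<in>{1..horizon I}. yy S i \<in> {0, 1}) \<and>
     (\<forall>j\<in>scenarios I. zz S j \<in> {0, 1})"

definition slscc_optimal :: "slscc \<Rightarrow> slscc_sol \<Rightarrow> bool" where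
  "slscc_optimal I S \<longleftrightarrow>
     slscc_feasible I S \<and> (\<forall>S'. slscc_feasible I S' \<longrightarrow> slscc_cost I S \<le> slscc_cost I S')"

text \<open>The convention \<open>\<alpha>\<^sub>T\<^sub>+\<^sub>1 = 0\<close>.\<close>

definition alpha_ext :: "slscc \<Rightarrow> nat \<Rightarrow> real" where
  "alpha_ext I i = (if i = horizon I + 1 then 0 else alpha I i)"

text \<open>The convention \<open>s\<^sub>j\<^sub>p = s\<^sub>p\<close>; only meant for \<open>i \<ge> p\<close>.\<close>

definition sinv :: "slscc \<Rightarrow> slscc_sol \<Rightarrow> nat \<Rightarrow> nat \<Rightarrow> real" where
  "sinv I S j i = (if i = stage I then inv1 S i else inv2 S j i)"

text \<open>\<open>\<psi>(i)\<close>; the disjunct \<open>k = T + 1\<close> is the convention \<open>y\<^sub>T\<^sub>+\<^sub>1 = 1\<close>.\<close>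

definition next_setup :: "slscc \<Rightarrow> slscc_sol \<Rightarrow> nat \<Rightarrow> nat" where
  "next_setup I S i = Min {k \<in> {i + 1..horizon I + 1}. k = horizon I + 1 \<or> yy S k = 1}"

text \<open>\<open>\<phi>(i)\<close>; adding 0 to the set gives \<open>\<phi>(i) = 0\<close> exactly when no period before \<open>i\<close>
  is set up.\<close>

definition last_setup :: "slscc_sol \<Rightarrow> nat \<Rightarrow> nat" where
  "last_setup S i = Max (insert 0 {k \<in> {1..i - 1}. yy S k = 1})"

definition served :: "slscc \<Rightarrow> slscc_sol \<Rightarrow> nat set" where  (* J_z *)
  "served I S = {j \<in> scenarios I. zz S j = 0}"

text \<open>Maximum over \<open>J\<^sub>z\<close>, taken to be 0 when \<open>J\<^sub>z\<close> is empty. In a feasible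
  solution \<open>J\<^sub>z\<close> can be empty only if the risk threshold is at least 1.\<close>

definition max_served :: "slscc \<Rightarrow> slscc_sol \<Rightarrow> (nat \<Rightarrow> real) \<Rightarrow> real" where
  "max_served I S f = (if served I S = {} then 0 else (MAX j\<in>served I S. f j))"

end

theory Submission
  imports Defs
begin

text \<open>Fix the set \<open>A\<close> of periods that are set up and the set \<open>J\<close> of served
scenarios. What remains of the problem concerns only the cumulative production
\<open>X\<^sub>t = x\<^sub>1 + \<dots> + x\<^sub>t\<close>. It must be nondecreasing, can grow only in periods of
\<open>A\<close>, and must cover in every period \<open>t\<close> the \<open>requirement\<close>: the first-stage demand up
to \<open>t\<close> plus the largest second-stage demand up to \<open>t\<close> among the scenarios of \<open>J\<close>.
Between two setups \<open>X\<close> is constant, so \<open>X\<^sub>i\<close> must already cover the requirement at the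
end of the period before \<open>\<psi>(i)\<close> (\<open>feasible_level_le\<close>). This lower bound is itself
an admissible \<open>X\<close>, and it respects the bounds \<open>M\<^sub>i\<close>, because a lot then covers no more
than the growth of the requirement until the next setup (\<open>least_plan_feasible\<close>).
So for each pair \<open>(A, J)\<close> that comes from a feasible solution there is a plan that is
least in all periods at once.

Inventories are cumulative production minus demand. Summation by parts turns the cost
into a constant depending on \<open>(A, J)\<close> plus \<open>\<Sum>\<^sub>i c\<^sub>i X\<^sub>i\<close>, plus a nonnegative
charge for recording more second-stage inventory than necessary (\<open>cost_by_cumx\<close>).
Here \<open>c\<^sub>i\<close> is \<open>\<alpha>\<^sub>i - \<alpha>\<^sub>i\<^sub>+\<^sub>1 + h\<^sub>i\<close> in the first stage and
\<open>\<alpha>\<^sub>i - \<alpha>\<^sub>i\<^sub>+\<^sub>1 + P(J) h\<^sub>i\<close> in the second, where the probability \<open>P(J)\<close> of the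
served scenarios is at least \<open>1 - \<epsilon>\<close> by the chance constraint. The Wagner--Whitin
condition and \<open>h\<^sub>i \<ge> 0\<close> in the second stage give \<open>c\<^sub>i \<ge> 0\<close>, and the least plan is at most as expensive as any
feasible solution with the same \<open>(A, J)\<close> (\<open>least_plan_cost_le\<close>). As there are only
finitely many pairs \<open>(A, J)\<close>, the cheapest least plan is an optimal solution; this also
settles that an optimum is attained. The formulas (a)--(d) are the values of the least
plan, read off from \<open>X\<^sub>i\<close> being the requirement just before \<open>\<psi>(i)\<close>.\<close>

section \<open>Maxima over the served scenarios\<close>

text \<open>The maximum is a function of the set \<open>J\<close> alone, so that the sets
\<open>(A, J)\<close> can be chosen first and the solution built from them afterwards.\<close>

definition max_over :: "nat set \<Rightarrow> (nat \<Rightarrow> real) \<Rightarrow> real" where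
  "max_over J f = (if J = {} then 0 else (MAX j\<in>J. f j))"

lemma max_served_eq_max_over: "max_served I S = max_over (served I S)"
  by (rule ext) (simp add: max_served_def max_over_def)

lemma le_max_over: "finite J \<Longrightarrow> j \<in> J \<Longrightarrow> f j \<le> max_over J f"
  by (auto simp: max_over_def)

lemma max_over_least:
  assumes "finite J" "\<And>j. j \<in> J \<Longrightarrow> f j \<le> b" "J = {} \<Longrightarrow> 0 \<le> b"
  shows "max_over J f \<le> b"
  using assms by (auto simp: max_over_def)

lemma max_over_mono:
  assumes "finite J" "\<And>j. j \<in> J \<Longrightarrow> f j \<le> g j"
  shows "max_over J f \<le> max_over J g"
proof (rule max_over_least[OF assms(1)])
  show "f j \<le> max_over J g" if "j \<in> J" for j
    using assms(2)[OF that] le_max_over[OF assms(1) that, of g] by (rule order_trans)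
qed (simp add: max_over_def)

lemma max_over_zero: "max_over J (\<lambda>_. 0) = 0"
  by (simp add: max_over_def image_constant_conv)

lemma max_over_add_const:
  assumes "finite J" "J \<noteq> {}"
  shows "max_over J (\<lambda>j. f j + c) = max_over J f + c"
proof (rule antisym)
  show "max_over J (\<lambda>j. f j + c) \<le> max_over J f + c"
    using assms by (intro max_over_least) (auto simp: le_max_over)
  have "max_over J f \<le> max_over J (\<lambda>j. f j + c) - c"
  proof (rule max_over_least)
    show "f j \<le> max_over J (\<lambda>j. f j + c) - c" if "j \<in> J" for j
      using le_max_over[OF assms(1) that, of "\<lambda>j. f j + c"] by simp
  qed (use assms in auto)
  then show "max_over J f + c \<le> max_over J (\<lambda>j. f j + c)" by simp
qed

section \<open>The next setup period\<close>

text \<open>This is \<open>\<psi>(i)\<close> as a function of the set of setup periods.\<close>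

definition next_in :: "slscc \<Rightarrow> nat set \<Rightarrow> nat \<Rightarrow> nat" where
  "next_in I A i = Min {k \<in> {i + 1..horizon I + 1}. k = horizon I + 1 \<or> k \<in> A}"

definition setups :: "slscc \<Rightarrow> slscc_sol \<Rightarrow> nat set" where
  "setups I S = {k \<in> {1..horizon I}. yy S k = 1}"

lemma next_setup_eq_next_in: "next_setup I S i = next_in I (setups I S) i"
  unfolding next_setup_def next_in_def setups_def by (rule arg_cong[where f = Min]) auto

lemma next_in_props:
  assumes "i \<le> horizon I"
  shows "i < next_in I A i" "next_in I A i \<le> horizon I + 1"
    "\<And>k. i < k \<Longrightarrow> k < next_in I A i \<Longrightarrow> k \<notin> A"
    "next_in I A i = horizon I + 1 \<or> next_in I A i \<in> A"
proof -
  let ?K = "{k \<in> {i + 1..horizon I + 1}. k = horizon I + 1 \<or> k \<in> A}"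
  have fin: "finite ?K" by simp
  have "horizon I + 1 \<in> ?K" using assms by simp
  then have mem: "next_in I A i \<in> ?K"
    unfolding next_in_def by (intro Min_in[OF fin]) blast
  then show "i < next_in I A i" "next_in I A i \<le> horizon I + 1"
    "next_in I A i = horizon I + 1 \<or> next_in I A i \<in> A" by auto
  show "k \<notin> A" if "i < k" "k < next_in I A i" for k
  proof
    assume "k \<in> A"
    then have "k \<in> ?K" using that mem by auto
    then have "next_in I A i \<le> k" unfolding next_in_def by (rule Min_le[OF fin])
    then show False using that by simp
  qed
qed

lemma next_in_setup:
  assumes "i \<in> {1..horizon I}" "i \<in> A"
  shows "next_in I A (i - 1) = i"
proof -
  have "i - 1 \<le> horizon I" using assms(1) by auto
  note P = next_in_props[OF this, where A = A]
  show ?thesis using P(1) P(3)[of i] assms by fastforce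
qed

lemma next_in_no_setup:
  assumes "i \<in> {1..horizon I}" "i \<notin> A"
  shows "next_in I A (i - 1) = next_in I A i"
proof -
  have *: "{k \<in> {i - 1 + 1..horizon I + 1}. k = horizon I + 1 \<or> k \<in> A}
    = {k \<in> {i + 1..horizon I + 1}. k = horizon I + 1 \<or> k \<in> A}" (is "?L = ?R")
  proof
    show "?L \<subseteq> ?R" using assms by (auto intro: Suc_leI le_neq_implies_less)
  qed (use assms in auto)
  show ?thesis unfolding next_in_def * ..
qed

section \<open>Least cumulative production for given setups and served scenarios\<close>

definition first_dem :: "slscc \<Rightarrow> nat \<Rightarrow> real" where
  "first_dem I t = (\<Sum>i=1..min t (stage I). dem I i)"

definition second_dem :: "slscc \<Rightarrow> nat \<Rightarrow> nat \<Rightarrow> real" where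
  "second_dem I j t = (\<Sum>i=stage I + 1..t. sdem I j i)"

text \<open>The requirement covers both stages at once: up to period \<open>p\<close> the second-stage maximum is
\<open>0\<close>, and from \<open>p\<close> on the first-stage part stays constant. This uniform formula
spares a case distinction whenever a lot reaches across the end of the first stage.\<close>

definition requirement :: "slscc \<Rightarrow> nat set \<Rightarrow> nat \<Rightarrow> real" where
  "requirement I J t = first_dem I t + max_over J (\<lambda>j. second_dem I j t)"

definition level :: "slscc \<Rightarrow> nat set \<Rightarrow> nat set \<Rightarrow> nat \<Rightarrow> real" where
  "level I A J i = requirement I J (next_in I A i - 1)"

definition cumx :: "slscc_sol \<Rightarrow> nat \<Rightarrow> real" where
  "cumx S t = (\<Sum>i=1..t. xx S i)"

lemma first_dem_mono:
  assumes "slscc_data I" "s \<le> t"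
  shows "first_dem I s \<le> first_dem I t"
  unfolding first_dem_def using assms by (intro sum_mono2) (auto simp: slscc_data_def)

lemma second_dem_mono:
  assumes "slscc_data I" "j \<in> scenarios I" "s \<le> t" "t \<le> horizon I"
  shows "second_dem I j s \<le> second_dem I j t"
  unfolding second_dem_def using assms by (intro sum_mono2) (auto simp: slscc_data_def)

lemma second_dem_early: "t \<le> stage I \<Longrightarrow> second_dem I j t = 0"
  by (simp add: second_dem_def)

lemma second_dem_nonneg:
  assumes "slscc_data I" "j \<in> scenarios I" "t \<le> horizon I"
  shows "0 \<le> second_dem I j t"
  unfolding second_dem_def using assms by (intro sum_nonneg) (auto simp: slscc_data_def)

lemma first_dem_late: "stage I \<le> t \<Longrightarrow> first_dem I t = first_dem I (stage I)"
  by (simp add: first_dem_def)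

lemma first_dem_split:
  assumes "i \<le> t" "t \<le> stage I"
  shows "first_dem I t = first_dem I i + (\<Sum>k=i + 1..t. dem I k)"
proof -
  have "{1..t} = {1..i} \<union> {i + 1..t}" using assms by auto
  then show ?thesis using assms by (simp add: first_dem_def sum.union_disjoint min_absorb1)
qed

lemma second_dem_split:
  assumes "stage I \<le> i" "i \<le> t"
  shows "second_dem I j t = second_dem I j i + (\<Sum>k=i + 1..t. sdem I j k)"
proof -
  have "{stage I + 1..t} = {stage I + 1..i} \<union> {i + 1..t}" using assms by auto
  then show ?thesis by (simp add: second_dem_def sum.union_disjoint)
qed

lemma requirement_early: "t \<le> stage I \<Longrightarrow> requirement I J t = first_dem I t"
  by (simp add: requirement_def second_dem_early max_over_zero)

lemma finite_scenario_subset: "J \<subseteq> scenarios I \<Longrightarrow> finite J"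
  by (rule finite_subset) auto

lemma requirement_mono:
  assumes "slscc_data I" "J \<subseteq> scenarios I" "s \<le> t" "t \<le> horizon I"
  shows "requirement I J s \<le> requirement I J t"
  unfolding requirement_def using assms finite_scenario_subset[OF assms(2)]
  by (intro add_mono first_dem_mono max_over_mono second_dem_mono) auto

lemma requirement_nonneg:
  assumes "slscc_data I" "J \<subseteq> scenarios I" "t \<le> horizon I"
  shows "0 \<le> requirement I J t"
  using requirement_mono[OF assms(1,2) le0 assms(3)]
  by (simp add: requirement_early first_dem_def)

lemma level_setup:
  assumes "i \<in> {1..horizon I}" "i \<in> A"
  shows "level I A J (i - 1) = requirement I J (i - 1)"
  using next_in_setup[OF assms] by (simp add: level_def)

lemma level_no_setup:
  assumes "i \<in> {1..horizon I}" "i \<notin> A"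
  shows "level I A J (i - 1) = level I A J i"
  using next_in_no_setup[OF assms] by (simp add: level_def)

lemma requirement_le_level:
  assumes "slscc_data I" "J \<subseteq> scenarios I" "i \<le> horizon I"
  shows "requirement I J i \<le> level I A J i"
  unfolding level_def using next_in_props(1,2)[OF assms(3), of A] assms
  by (intro requirement_mono) auto

lemma level_step:
  assumes "slscc_data I" "J \<subseteq> scenarios I" "i \<in> {1..horizon I}"
  shows "level I A J (i - 1) \<le> level I A J i"
proof (cases "i \<in> A")
  case True
  have "requirement I J (i - 1) \<le> requirement I J i"
    using assms by (intro requirement_mono) auto
  also have "\<dots> \<le> level I A J i" using assms by (intro requirement_le_level) auto
  finally show ?thesis using level_setup[OF assms(3) True] by simp
next
  case False
  then show ?thesis using level_no_setup[OF assms(3)] by simp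
qed

lemma cumx_split:
  assumes "i \<le> t"
  shows "cumx S t = cumx S i + (\<Sum>k=i + 1..t. xx S k)"
proof -
  have "{1..t} = {1..i} \<union> {i + 1..t}" using assms by auto
  then show ?thesis by (simp add: cumx_def sum.union_disjoint)
qed

lemma feasible_inv1:
  assumes "slscc_feasible I S" "i \<le> stage I"
  shows "inv1 S i = cumx S i - first_dem I i"
  using assms(2)
proof (induction i)
  case 0
  then show ?case using assms(1) by (simp add: slscc_feasible_def cumx_def first_dem_def)
next
  case (Suc i)
  have "\<forall>i\<in>{1..stage I}. xx S i + inv1 S (i - 1) = dem I i + inv1 S i"
    using assms(1) by (simp add: slscc_feasible_def)
  from this[rule_format, of "Suc i"] Suc.prems
  have "xx S (Suc i) + inv1 S i = dem I (Suc i) + inv1 S (Suc i)" by simp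
  moreover have "first_dem I (Suc i) = first_dem I i + dem I (Suc i)"
    using Suc.prems by (simp add: first_dem_def min_absorb1)
  ultimately show ?case using Suc by (simp add: cumx_def)
qed

text \<open>When no scenario is served, the claim in the second stage is that production never falls
below the first-stage demand, which follows from the nonnegative inventory \<open>s\<^sub>p\<close>.\<close>

lemma feasible_requirement_le:
  assumes data: "slscc_data I" and feas: "slscc_feasible I S" and t: "t \<le> horizon I"
  shows "requirement I (served I S) t \<le> cumx S t"
proof (cases "t \<le> stage I")
  case True
  have "0 \<le> inv1 S t" using feas True by (cases "t = 0") (auto simp: slscc_feasible_def)
  then show ?thesis using feasible_inv1[OF feas True] by (simp add: True requirement_early)
next
  case False
  have split: "cumx S t = cumx S (stage I) + (\<Sum>k=stage I + 1..t. xx S k)"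
    using False by (intro cumx_split) simp
  have p: "0 \<le> inv1 S (stage I)" using feas data
    by (auto simp: slscc_feasible_def slscc_data_def)
  note inv = feasible_inv1[OF feas order_refl]
  have "max_over (served I S) (\<lambda>j. second_dem I j t) \<le> cumx S t - first_dem I (stage I)"
  proof (rule max_over_least)
    show "finite (served I S)" by (simp add: served_def)
    fix j assume "j \<in> served I S"
    then have j: "j \<in> scenarios I" "zz S j = 0" by (auto simp: served_def)
    have "t \<in> {stage I + 1..horizon I}" using False t by simp
    with feas j(1) have "inv1 S (stage I) + (\<Sum>i=stage I + 1..t. xx S i)
          \<ge> (\<Sum>i=stage I + 1..t. sdem I j i * (1 - zz S j))"
      unfolding slscc_feasible_def by blast
    then show "second_dem I j t \<le> cumx S t - first_dem I (stage I)"
      using split inv j by (simp add: second_dem_def)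
  next
    have "0 \<le> (\<Sum>k=stage I + 1..t. xx S k)"
      using feas t by (intro sum_nonneg) (auto simp: slscc_feasible_def)
    then show "0 \<le> cumx S t - first_dem I (stage I)" using split inv p by simp
  qed
  then show ?thesis using False first_dem_late[of I t] by (simp add: requirement_def)
qed

text \<open>No production is possible strictly between \<open>i\<close> and the next setup, so the requirement
just before that setup has to be met by what has been produced through period \<open>i\<close>.
For \<open>i = 0\<close> the bound says that nothing is required before the first setup.\<close>

lemma feasible_level_le:
  assumes data: "slscc_data I" and feas: "slscc_feasible I S" and i: "i \<le> horizon I"
  shows "level I (setups I S) (served I S) i \<le> cumx S i"
proof -
  let ?n = "next_in I (setups I S) i"
  note P = next_in_props[OF i, where A = "setups I S"]
  have "xx S k = 0" if "k \<in> {i + 1..?n - 1}" for k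
  proof -
    have k: "k \<in> {1..horizon I}" "k \<notin> setups I S" using that P(1,2) P(3)[of k] by force+
    then have "yy S k = 0" using feas by (auto simp: slscc_feasible_def setups_def)
    moreover have "xx S k \<le> bigM I k * yy S k" "0 \<le> xx S k"
      using feas k(1) unfolding slscc_feasible_def by blast+
    ultimately show ?thesis by simp
  qed
  then have "cumx S (?n - 1) = cumx S i"
    using cumx_split[of i "?n - 1" S] P(1) by simp
  moreover have "requirement I (served I S) (?n - 1) \<le> cumx S (?n - 1)"
    using P(2) by (intro feasible_requirement_le[OF data feas]) simp
  ultimately show ?thesis by (simp add: level_def)
qed

section \<open>The cost as a function of cumulative production\<close>

lemma sum_by_parts:
  fixes a x :: "nat \<Rightarrow> real"
  shows "(\<Sum>i=1..n. a i * x i)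
    = (\<Sum>i=1..n. (a i - a (i + 1)) * (\<Sum>k=1..i. x k)) + a (n + 1) * (\<Sum>k=1..n. x k)"
  by (induction n) (simp_all add: algebra_simps)

text \<open>The cost of raising \<open>X\<^sub>i\<close> by one unit with all other \<open>X\<^sub>k\<close> unchanged: one unit of
production moves from period \<open>i + 1\<close> to period \<open>i\<close> (in the last period it is extra) and
is held for one period, in the second stage only in the served scenarios.\<close>

definition marginal_cost :: "slscc \<Rightarrow> nat set \<Rightarrow> nat \<Rightarrow> real" where
  "marginal_cost I J i = alpha I i - alpha_ext I (i + 1)
     + (if i \<le> stage I then 1 else (\<Sum>j\<in>J. prb I j)) * hold I i"

definition fixed_cost :: "slscc \<Rightarrow> nat set \<Rightarrow> nat set \<Rightarrow> real" where
  "fixed_cost I A J = (\<Sum>i\<in>A. beta I i) - (\<Sum>i=1..stage I. hold I i * first_dem I i)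
     - (\<Sum>j\<in>J. prb I j * (\<Sum>i=stage I + 1..horizon I.
          hold I i * (first_dem I (stage I) + second_dem I j i)))"

text \<open>The least second-stage inventory that the constraints permit for the given production.\<close>

definition tight_inv2 :: "slscc \<Rightarrow> slscc_sol \<Rightarrow> nat \<Rightarrow> nat \<Rightarrow> real" where
  "tight_inv2 I S j i =
     (if zz S j = 0 then cumx S i - first_dem I (stage I) - second_dem I j i else 0)"

lemma sum_periods_split:
  fixes f :: "nat \<Rightarrow> real"
  assumes "slscc_data I"
  shows "(\<Sum>i=1..horizon I. f i) = (\<Sum>i=1..stage I. f i) + (\<Sum>i=stage I + 1..horizon I. f i)"
proof -
  have "{1..horizon I} = {1..stage I} \<union> {stage I + 1..horizon I}"
    using assms by (auto simp: slscc_data_def)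
  then show ?thesis by (simp add: sum.union_disjoint)
qed

lemma cost_by_cumx:
  assumes data: "slscc_data I" and feas: "slscc_feasible I S"
  shows "slscc_cost I S = fixed_cost I (setups I S) (served I S)
    + (\<Sum>i=1..horizon I. marginal_cost I (served I S) i * cumx S i)
    + (\<Sum>j\<in>scenarios I. prb I j *
         (\<Sum>i=stage I + 1..horizon I. hold I i * (inv2 S j i - tight_inv2 I S j i)))"
proof -
  let ?p = "stage I" and ?T = "horizon I" and ?J = "served I S"
  have production: "(\<Sum>i=1..?T. alpha I i * xx S i)
    = (\<Sum>i=1..?T. (alpha I i - alpha_ext I (i + 1)) * cumx S i)"
  proof -
    have "(\<Sum>i=1..?T. alpha I i * xx S i) = (\<Sum>i=1..?T. alpha_ext I i * xx S i)"
      by (intro sum.cong) (auto simp: alpha_ext_def)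
    also have "\<dots> = (\<Sum>i=1..?T. (alpha_ext I i - alpha_ext I (i + 1)) * cumx S i)"
      using sum_by_parts[of "alpha_ext I" "xx S" ?T] by (simp add: alpha_ext_def cumx_def)
    also have "\<dots> = (\<Sum>i=1..?T. (alpha I i - alpha_ext I (i + 1)) * cumx S i)"
      by (intro sum.cong) (auto simp: alpha_ext_def)
    finally show ?thesis .
  qed
  have setup_cost: "(\<Sum>i=1..?T. beta I i * yy S i) = (\<Sum>i\<in>setups I S. beta I i)"
  proof -
    have "(\<Sum>i=1..?T. beta I i * yy S i) = (\<Sum>i=1..?T. if yy S i = 1 then beta I i else 0)"
      using feas by (intro sum.cong) (auto simp: slscc_feasible_def)
    also have "\<dots> = (\<Sum>i\<in>setups I S. beta I i)"
      unfolding setups_def by (rule sum.inter_filter[symmetric]) simp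
    finally show ?thesis .
  qed
  have hold1: "(\<Sum>i=1..?p. hold I i * inv1 S i)
    = (\<Sum>i=1..?p. hold I i * cumx S i) - (\<Sum>i=1..?p. hold I i * first_dem I i)"
    by (simp add: feasible_inv1[OF feas] sum_subtractf right_diff_distrib)
  have hold2: "(\<Sum>j\<in>scenarios I. prb I j * (\<Sum>i=?p + 1..?T. hold I i * tight_inv2 I S j i))
    = (\<Sum>i=?p + 1..?T. (\<Sum>j\<in>?J. prb I j) * hold I i * cumx S i)
      - (\<Sum>j\<in>?J. prb I j * (\<Sum>i=?p + 1..?T.
          hold I i * (first_dem I ?p + second_dem I j i)))"
  proof -
    have "(\<Sum>j\<in>scenarios I. prb I j * (\<Sum>i=?p + 1..?T. hold I i * tight_inv2 I S j i))
      = (\<Sum>j\<in>?J. prb I j * (\<Sum>i=?p + 1..?T. hold I i * tight_inv2 I S j i))"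
      by (intro sum.mono_neutral_right) (auto simp: served_def tight_inv2_def)
    also have "\<dots> = (\<Sum>j\<in>?J. prb I j * (\<Sum>i=?p + 1..?T. hold I i * cumx S i)
        - prb I j * (\<Sum>i=?p + 1..?T. hold I i * (first_dem I ?p + second_dem I j i)))"
      by (intro sum.cong refl)
        (simp add: served_def tight_inv2_def right_diff_distrib[symmetric]
          sum_subtractf[symmetric] algebra_simps)
    also have "\<dots> = (\<Sum>j\<in>?J. prb I j) * (\<Sum>i=?p + 1..?T. hold I i * cumx S i)
        - (\<Sum>j\<in>?J. prb I j * (\<Sum>i=?p + 1..?T.
            hold I i * (first_dem I ?p + second_dem I j i)))"
      by (simp only: sum_subtractf sum_distrib_right)
    finally show ?thesis by (simp only: sum_distrib_left mult.assoc)
  qed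
  have marginal: "(\<Sum>i=1..?T. marginal_cost I ?J i * cumx S i)
    = (\<Sum>i=1..?T. (alpha I i - alpha_ext I (i + 1)) * cumx S i)
      + (\<Sum>i=1..?p. hold I i * cumx S i)
      + (\<Sum>i=?p + 1..?T. (\<Sum>j\<in>?J. prb I j) * hold I i * cumx S i)"
    unfolding sum_periods_split[OF data] marginal_cost_def
    by (simp add: algebra_simps sum.distrib sum_subtractf)
  have "slscc_cost I S = (\<Sum>i=1..?T. alpha I i * xx S i) + (\<Sum>i=1..?T. beta I i * yy S i)
    + (\<Sum>i=1..?p. hold I i * inv1 S i)
    + (\<Sum>j\<in>scenarios I. prb I j * (\<Sum>i=?p + 1..?T. hold I i * inv2 S j i))"
    unfolding slscc_cost_def sum_periods_split[OF data] by (simp add: sum.distrib)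
  moreover have "(\<Sum>j\<in>scenarios I. prb I j *
         (\<Sum>i=?p + 1..?T. hold I i * (inv2 S j i - tight_inv2 I S j i)))
    = (\<Sum>j\<in>scenarios I. prb I j * (\<Sum>i=?p + 1..?T. hold I i * inv2 S j i))
      - (\<Sum>j\<in>scenarios I. prb I j * (\<Sum>i=?p + 1..?T. hold I i * tight_inv2 I S j i))"
    by (simp add: right_diff_distrib sum_subtractf)
  ultimately show ?thesis
    using production setup_cost hold1 hold2 marginal by (simp add: fixed_cost_def)
qed

text \<open>The chance constraint bounds the probability of the scenarios that are not served.\<close>

lemma served_prob_ge:
  assumes data: "slscc_data I" and feas: "slscc_feasible I S"
  shows "1 - risk I \<le> (\<Sum>j\<in>served I S. prb I j)"
proof -
  have "(\<Sum>j\<in>served I S. prb I j) = (\<Sum>j\<in>scenarios I. if zz S j = 0 then prb I j else 0)"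
    unfolding served_def by (rule sum.inter_filter) simp
  also have "\<dots> = (\<Sum>j\<in>scenarios I. prb I j - prb I j * zz S j)"
    using feas by (intro sum.cong) (auto simp: slscc_feasible_def)
  also have "\<dots> = 1 - (\<Sum>j\<in>scenarios I. prb I j * zz S j)"
    using data by (simp add: sum_subtractf slscc_data_def)
  finally show ?thesis using feas by (simp add: slscc_feasible_def)
qed

lemma feasible_inv2_ge:
  assumes data: "slscc_data I" and feas: "slscc_feasible I S"
    and j: "j \<in> scenarios I" and i: "i \<in> {stage I + 1..horizon I}"
  shows "tight_inv2 I S j i \<le> inv2 S j i"
proof (cases "zz S j = 0")
  case True
  have "inv2 S j i
      \<ge> ((\<Sum>t=stage I + 1..i. xx S t - sdem I j t) + inv1 S (stage I)) * (1 - zz S j)"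
    using feas j i unfolding slscc_feasible_def by blast
  then show ?thesis
    using True feasible_inv1[OF feas order_refl] cumx_split[of "stage I" i S] i
    by (simp add: tight_inv2_def second_dem_def sum_subtractf)
next
  case False
  then show ?thesis using feas j i by (auto simp: tight_inv2_def slscc_feasible_def)
qed

section \<open>The least plan\<close>

text \<open>The setup and service indicators are fixed outside the index ranges as well, so that the
plan is determined by \<open>A\<close> and \<open>J\<close>; this leaves only finitely many plans. The value
\<open>s\<^sub>0\<close> given by the formula is the level at \<open>0\<close>, so the constraint \<open>s\<^sub>0 = 0\<close> is
met exactly if the level at \<open>0\<close> vanishes.\<close>

definition least_plan :: "slscc \<Rightarrow> nat set \<Rightarrow> nat set \<Rightarrow> slscc_sol" where
  "least_plan I A J =
     \<lparr> xx = \<lambda>i. level I A J i - level I A J (i - 1),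
       yy = \<lambda>i. if i \<in> A then 1 else 0,
       inv1 = \<lambda>i. level I A J i - first_dem I i,
       inv2 = \<lambda>j i. if j \<in> J then level I A J i - first_dem I (stage I) - second_dem I j i else 0,
       zz = \<lambda>j. if j \<in> J then 0 else 1 \<rparr>"

lemma setups_least_plan: "A \<subseteq> {1..horizon I} \<Longrightarrow> setups I (least_plan I A J) = A"
  by (auto simp: setups_def least_plan_def)

lemma served_least_plan: "J \<subseteq> scenarios I \<Longrightarrow> served I (least_plan I A J) = J"
  by (auto simp: served_def least_plan_def)

lemma sum_level_diff:
  "s \<le> t \<Longrightarrow> (\<Sum>i=s + 1..t. level I A J i - level I A J (i - 1)) = level I A J t - level I A J s"
  by (induction t rule: dec_induct) auto

lemma cumx_least_plan: "level I A J 0 = 0 \<Longrightarrow> cumx (least_plan I A J) t = level I A J t"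
  using sum_level_diff[of 0 t I A J] by (simp add: cumx_def least_plan_def)

lemma second_dem_le_level:
  assumes "slscc_data I" "J \<subseteq> scenarios I" "j \<in> J" "i \<in> {stage I + 1..horizon I}"
  shows "first_dem I (stage I) + second_dem I j i \<le> level I A J i"
proof -
  have "first_dem I (stage I) + second_dem I j i \<le> requirement I J i"
    using assms le_max_over[OF finite_scenario_subset[OF assms(2)] assms(3), of "\<lambda>j. second_dem I j i"]
      first_dem_late[of I i] by (simp add: requirement_def)
  also have "\<dots> \<le> level I A J i" using assms by (intro requirement_le_level) auto
  finally show ?thesis .
qed

lemma scenarios_nonempty: "slscc_data I \<Longrightarrow> scenarios I \<noteq> {}"
  by (intro notI) (simp add: slscc_data_def)

text \<open>In the second stage the point is that a difference of maxima is at most the maximum of the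
differences: the scenario attaining the maximum at \<open>t\<close> had at \<open>i - 1\<close> at most
the maximal demand.\<close>

lemma requirement_diff_le_bigM:
  assumes data: "slscc_data I" and J: "J \<subseteq> scenarios I" and i: "1 \<le> i" "i \<le> t" "t \<le> horizon I"
  shows "requirement I J t - requirement I J (i - 1) \<le> bigM I i"
proof (cases "i \<le> stage I")
  case True
  let ?m = "max_over J (\<lambda>j. second_dem I j t)"
  have "?m \<le> (MAX j\<in>scenarios I. second_dem I j (horizon I))"
  proof (rule max_over_least[OF finite_scenario_subset[OF J]])
    fix j assume "j \<in> J"
    then have j: "j \<in> scenarios I" using J by auto
    have "second_dem I j t \<le> second_dem I j (horizon I)"
      using second_dem_mono[OF data j] i by simp
    also have "\<dots> \<le> (MAX j\<in>scenarios I. second_dem I j (horizon I))" using j by (intro Max_ge) auto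
    finally show "second_dem I j t \<le> (MAX j\<in>scenarios I. second_dem I j (horizon I))" .
  next
    obtain j where j: "j \<in> scenarios I" using scenarios_nonempty[OF data] by blast
    have "0 \<le> second_dem I j (horizon I)" using second_dem_nonneg[OF data j] by simp
    also have "\<dots> \<le> (MAX j\<in>scenarios I. second_dem I j (horizon I))" using j by (intro Max_ge) auto
    finally show "0 \<le> (MAX j\<in>scenarios I. second_dem I j (horizon I))" .
  qed
  moreover have "first_dem I t \<le> first_dem I (stage I)"
    using first_dem_mono[OF data, of t "stage I"] first_dem_late[of I t] by (cases "t \<le> stage I") auto
  moreover have "first_dem I (stage I) = first_dem I (i - 1) + (\<Sum>k=i..stage I. dem I k)"
    using first_dem_split[of "i - 1" "stage I" I] True i by simp
  moreover have "requirement I J (i - 1) = first_dem I (i - 1)"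
    using True by (intro requirement_early) simp
  moreover have "bigM I i = (\<Sum>k=i..stage I. dem I k)
      + (MAX j\<in>scenarios I. second_dem I j (horizon I))"
    using True by (simp add: bigM_def second_dem_def)
  moreover have "requirement I J t = first_dem I t + ?m" by (simp add: requirement_def)
  ultimately show ?thesis by linarith
next
  case False
  let ?prev = "max_over J (\<lambda>j. second_dem I j (i - 1))"
  have le_M: "(\<Sum>k=i..t. sdem I j k) \<le> bigM I i" if j: "j \<in> scenarios I" for j
  proof -
    have "(\<Sum>k=i..t. sdem I j k) \<le> (\<Sum>k=i..horizon I. sdem I j k)"
      using data j False i by (intro sum_mono2) (auto simp: slscc_data_def)
    also have "\<dots> \<le> (MAX j\<in>scenarios I. \<Sum>k=i..horizon I. sdem I j k)"
      using j by (intro Max_ge) auto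
    finally show ?thesis using False by (simp add: bigM_def)
  qed
  have "max_over J (\<lambda>j. second_dem I j t) \<le> bigM I i + ?prev"
  proof (rule max_over_least[OF finite_scenario_subset[OF J]])
    fix j assume j: "j \<in> J"
    have "second_dem I j t = second_dem I j (i - 1) + (\<Sum>k=i..t. sdem I j k)"
      using second_dem_split[of I "i - 1" t j] False i by simp
    moreover have "second_dem I j (i - 1) \<le> ?prev"
      by (rule le_max_over[OF finite_scenario_subset[OF J] j])
    moreover have "(\<Sum>k=i..t. sdem I j k) \<le> bigM I i" using j J by (intro le_M) auto
    ultimately show "second_dem I j t \<le> bigM I i + ?prev" by linarith
  next
    assume "J = {}"
    obtain j where j: "j \<in> scenarios I" using scenarios_nonempty[OF data] by blast
    have "0 \<le> (\<Sum>k=i..t. sdem I j k)"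
      using data j False i by (intro sum_nonneg) (auto simp: slscc_data_def)
    also have "\<dots> \<le> bigM I i" by (rule le_M[OF j])
    finally show "0 \<le> bigM I i + ?prev" using \<open>J = {}\<close> by (simp add: max_over_def)
  qed
  moreover have "first_dem I t = first_dem I (i - 1)"
    using False i first_dem_late[of I t] first_dem_late[of I "i - 1"] by simp
  ultimately show ?thesis by (simp add: requirement_def)
qed

text \<open>Production occurs only at setups because the level is constant between them. A lot at
\<open>i \<in> A\<close> starts from the level \<open>requirement (i - 1)\<close>, so its size is the growth of the
requirement, which \<open>M\<^sub>i\<close> bounds. The condition on the level at \<open>0\<close> excludes setup
sets that begin only after the requirement has become positive.\<close>

lemma least_plan_feasible:
  assumes data: "slscc_data I" and A: "A \<subseteq> {1..horizon I}" and J: "J \<subseteq> scenarios I"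
    and start: "level I A J 0 = 0" and risk: "(\<Sum>j\<in>scenarios I - J. prb I j) \<le> risk I"
  shows "slscc_feasible I (least_plan I A J)"
proof -
  let ?S = "least_plan I A J" and ?p = "stage I" and ?T = "horizon I" and ?L = "level I A J"
  have p: "?p \<le> ?T" using data by (simp add: slscc_data_def)
  have production: "(\<Sum>i=?p + 1..t. xx ?S i) = ?L t - ?L ?p" if "?p \<le> t" for t
    using sum_level_diff[OF that] by (simp add: least_plan_def)
  have "inv1 ?S 0 = 0" using start by (simp add: least_plan_def first_dem_def)
  moreover have "xx ?S i + inv1 ?S (i - 1) = dem I i + inv1 ?S i" if "i \<in> {1..?p}" for i
    using that first_dem_split[of "i - 1" i I] by (simp add: least_plan_def)
  moreover have "inv1 ?S ?p + (\<Sum>i=?p + 1..t. xx ?S i)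
      \<ge> (\<Sum>i=?p + 1..t. sdem I j i * (1 - zz ?S j))"
    if "t \<in> {?p + 1..?T}" "j \<in> scenarios I" for t j
  proof -
    have eq: "inv1 ?S ?p + (\<Sum>i=?p + 1..t. xx ?S i) = ?L t - first_dem I ?p"
      using production[of t] that by (simp add: least_plan_def)
    show ?thesis
    proof (cases "j \<in> J")
      case True
      then show ?thesis using second_dem_le_level[OF data J True that(1), of A] eq
        by (simp add: least_plan_def second_dem_def)
    next
      case False
      have "first_dem I ?p \<le> requirement I J t"
        using requirement_mono[OF data J, of ?p t] that by (simp add: requirement_early)
      also have "\<dots> \<le> ?L t" using that by (intro requirement_le_level[OF data J]) simp
      finally show ?thesis unfolding eq using False by (simp add: least_plan_def)
    qed
  qed
  moreover have "(\<Sum>j\<in>scenarios I. prb I j * zz ?S j) \<le> risk I"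
  proof -
    have "(\<Sum>j\<in>scenarios I. prb I j * zz ?S j) = (\<Sum>j\<in>scenarios I - J. prb I j * zz ?S j)"
      by (intro sum.mono_neutral_right) (auto simp: least_plan_def)
    also have "\<dots> = (\<Sum>j\<in>scenarios I - J. prb I j)"
      by (intro sum.cong) (auto simp: least_plan_def)
    finally show ?thesis using risk by simp
  qed
  moreover have "inv2 ?S j i
      \<ge> ((\<Sum>t=?p + 1..i. xx ?S t - sdem I j t) + inv1 ?S ?p) * (1 - zz ?S j)"
    if "i \<in> {?p + 1..?T}" for i j
    using production[of i] that by (simp add: sum_subtractf) (simp add: least_plan_def second_dem_def)
  moreover have "xx ?S i \<le> bigM I i * yy ?S i" if i: "i \<in> {1..?T}" for i
  proof (cases "i \<in> A")
    case True
    have "i \<le> ?T" using i by simp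
    note P = next_in_props[OF this, where A = A]
    have "?L i - ?L (i - 1) \<le> bigM I i"
      unfolding level_setup[OF i True] level_def[of I A J i]
      using i P(1,2) by (intro requirement_diff_le_bigM[OF data J]) auto
    then show ?thesis using True by (simp add: least_plan_def)
  next
    case False
    then show ?thesis using level_no_setup[OF i False] by (simp add: least_plan_def)
  qed
  moreover have "0 \<le> xx ?S i" if "i \<in> {1..?T}" for i
    using level_step[OF data J that, of A] by (simp add: least_plan_def)
  moreover have "0 \<le> inv1 ?S i" if "i \<in> {1..?p}" for i
    using requirement_le_level[OF data J, of i A] that p
    by (simp add: least_plan_def requirement_early)
  moreover have "0 \<le> inv2 ?S j i" if "i \<in> {?p + 1..?T}" for i j
    using second_dem_le_level[OF data J _ that, of j A] by (auto simp: least_plan_def)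
  moreover have "yy ?S i \<in> {0, 1}" "zz ?S j \<in> {0, 1}" for i j
    by (auto simp: least_plan_def)
  ultimately show ?thesis unfolding slscc_feasible_def by blast
qed

lemma least_plan_of_feasible:
  assumes data: "slscc_data I" and feas: "slscc_feasible I S"
  shows "slscc_feasible I (least_plan I (setups I S) (served I S))"
    and "level I (setups I S) (served I S) 0 = 0"
proof -
  have A: "setups I S \<subseteq> {1..horizon I}" and J: "served I S \<subseteq> scenarios I"
    by (auto simp: setups_def served_def)
  show start: "level I (setups I S) (served I S) 0 = 0"
  proof (rule antisym)
    show "level I (setups I S) (served I S) 0 \<le> 0"
      using feasible_level_le[OF data feas, of 0] by (simp add: cumx_def)
    show "0 \<le> level I (setups I S) (served I S) 0"
      using requirement_nonneg[OF data J, of 0] requirement_le_level[OF data J, of 0 "setups I S"]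
      by simp
  qed
  have "(\<Sum>j\<in>scenarios I - served I S. prb I j) = 1 - (\<Sum>j\<in>served I S. prb I j)"
    using data J by (subst sum_diff) (auto simp: slscc_data_def)
  then have "(\<Sum>j\<in>scenarios I - served I S. prb I j) \<le> risk I"
    using served_prob_ge[OF data feas] by simp
  then show "slscc_feasible I (least_plan I (setups I S) (served I S))"
    by (rule least_plan_feasible[OF data A J start])
qed

text \<open>The last period is included: with \<open>\<alpha>\<^sub>T\<^sub>+\<^sub>1 = 0\<close> the inequality there says that
producing beyond the total requirement does not pay.\<close>

definition wagner_whitin :: "slscc \<Rightarrow> bool" where
  "wagner_whitin I \<longleftrightarrow>
     (\<forall>i\<in>{1..stage I}. alpha_ext I (i + 1) \<le> alpha I i + hold I i) \<and>
     (\<forall>i\<in>{stage I + 1..horizon I}.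
        alpha_ext I (i + 1) \<le> alpha I i + (1 - risk I) * hold I i)"

text \<open>In the second stage \<open>1 - \<epsilon>\<close> may be replaced by the probability of the served
scenarios, as the holding costs of that stage are nonnegative.\<close>

lemma marginal_cost_nonneg:
  assumes data: "slscc_data I" and ww: "wagner_whitin I" and feas: "slscc_feasible I S"
    and i: "i \<in> {1..horizon I}"
  shows "0 \<le> marginal_cost I (served I S) i"
proof (cases "i \<le> stage I")
  case True
  then have "alpha_ext I (i + 1) \<le> alpha I i + hold I i"
    using ww i unfolding wagner_whitin_def by simp
  then show ?thesis using True by (simp add: marginal_cost_def)
next
  case False
  then have i2: "i \<in> {stage I + 1..horizon I}" using i by simp
  have "(1 - risk I) * hold I i \<le> (\<Sum>j\<in>served I S. prb I j) * hold I i"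
    using served_prob_ge[OF data feas] data i2
    by (intro mult_right_mono) (auto simp: slscc_data_def)
  moreover have "alpha_ext I (i + 1) \<le> alpha I i + (1 - risk I) * hold I i"
    using ww i2 by (auto simp: wagner_whitin_def)
  ultimately show ?thesis using False by (simp add: marginal_cost_def)
qed

text \<open>Both solutions have the same fixed cost; the least plan has lower cumulative production,
weighted with nonnegative marginal costs, and no superfluous second-stage inventory.\<close>

lemma least_plan_cost_le:
  assumes data: "slscc_data I" and ww: "wagner_whitin I" and feas: "slscc_feasible I S"
  shows "slscc_cost I (least_plan I (setups I S) (served I S)) \<le> slscc_cost I S"
proof -
  let ?A = "setups I S" and ?J = "served I S"
  let ?P = "least_plan I ?A ?J"
  note plan = least_plan_of_feasible[OF data feas]
  have same: "setups I ?P = ?A" "served I ?P = ?J"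
    by (rule setups_least_plan served_least_plan, force simp: setups_def served_def)+
  \<comment> \<open>The charge for superfluous second-stage inventory vanishes for the least plan.\<close>
  have "inv2 ?P j i = tight_inv2 I ?P j i" for j i
    using cumx_least_plan[OF plan(2)] by (simp add: tight_inv2_def) (simp add: least_plan_def)
  then have "slscc_cost I ?P = fixed_cost I ?A ?J
      + (\<Sum>i=1..horizon I. marginal_cost I ?J i * level I ?A ?J i)"
    using cost_by_cumx[OF data plan(1)] cumx_least_plan[OF plan(2)] by (simp add: same)
  also have "(\<Sum>i=1..horizon I. marginal_cost I ?J i * level I ?A ?J i)
      \<le> (\<Sum>i=1..horizon I. marginal_cost I ?J i * cumx S i)"
    by (intro sum_mono mult_left_mono feasible_level_le[OF data feas]
        marginal_cost_nonneg[OF data ww feas]) auto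
  also have "0 \<le> (\<Sum>j\<in>scenarios I. prb I j *
         (\<Sum>i=stage I + 1..horizon I. hold I i * (inv2 S j i - tight_inv2 I S j i)))"
    using data feasible_inv2_ge[OF data feas]
    by (intro sum_nonneg mult_nonneg_nonneg) (auto simp: slscc_data_def)
  ultimately show ?thesis using cost_by_cumx[OF data feas] by simp
qed

text \<open>Producing in every period for all scenarios is feasible: the first setup is in period 1, so
nothing is required before it, and the risk is 0.\<close>

lemma feasible_exists:
  assumes data: "slscc_data I"
  shows "slscc_feasible I (least_plan I {1..horizon I} (scenarios I))"
proof (rule least_plan_feasible[OF data])
  have "1 \<in> {1..horizon I}" using data by (auto simp: slscc_data_def)
  then show "level I {1..horizon I} (scenarios I) 0 = 0"
    using level_setup[of 1 I "{1..horizon I}"] by (simp add: requirement_early first_dem_def)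
qed (use data in \<open>auto simp: slscc_data_def\<close>)

text \<open>Solutions may have arbitrary real production levels, but each is dominated by one of
finitely many least plans.\<close>

lemma optimal_least_plan_exists:
  assumes data: "slscc_data I" and ww: "wagner_whitin I"
  obtains A J where "A \<subseteq> {1..horizon I}" "J \<subseteq> scenarios I" "level I A J 0 = 0"
    "slscc_optimal I (least_plan I A J)"
proof -
  let ?C = "(\<lambda>S. (setups I S, served I S)) ` {S. slscc_feasible I S}"
  let ?cost = "\<lambda>(A, J). slscc_cost I (least_plan I A J)"
  have "?C \<subseteq> Pow {1..horizon I} \<times> Pow (scenarios I)" by (auto simp: setups_def served_def)
  then have fin: "finite ?C" by (rule finite_subset) simp
  have "?C \<noteq> {}" using feasible_exists[OF data] by auto
  \<comment> \<open>The minimum is taken over the pairs that come from feasible solutions, as other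
    pairs may give infeasible plans.\<close>
  from ex_is_arg_min_if_finite[OF fin this, of ?cost]
  have "\<exists>c\<in>?C. \<forall>c'\<in>?C. ?cost c \<le> ?cost c'" by (auto simp: is_arg_min_linorder)
  then obtain S where S: "slscc_feasible I S"
    and least: "\<forall>c'\<in>?C. ?cost (setups I S, served I S) \<le> ?cost c'" by blast
  show ?thesis
  proof (rule that)
    show "setups I S \<subseteq> {1..horizon I}" "served I S \<subseteq> scenarios I"
      by (auto simp: setups_def served_def)
    show "level I (setups I S) (served I S) 0 = 0" by (rule least_plan_of_feasible(2)[OF data S])
    show "slscc_optimal I (least_plan I (setups I S) (served I S))"
      unfolding slscc_optimal_def
    proof (intro conjI allI impI)
      fix S' assume S': "slscc_feasible I S'"
      then have "slscc_cost I (least_plan I (setups I S) (served I S))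
          \<le> slscc_cost I (least_plan I (setups I S') (served I S'))"
        using least by auto
      also have "\<dots> \<le> slscc_cost I S'" by (rule least_plan_cost_le[OF data ww S'])
      finally show "slscc_cost I (least_plan I (setups I S) (served I S)) \<le> slscc_cost I S'" .
    qed (rule least_plan_of_feasible(1)[OF data S])
  qed
qed

section \<open>The form of the least plan\<close>

lemma level_next_early:
  assumes "i \<le> horizon I" "next_in I A i \<le> stage I"
  shows "level I A J i = first_dem I i + (\<Sum>t=i + 1..next_in I A i - 1. dem I t)"
  using next_in_props(1)[OF assms(1), of A] assms
    first_dem_split[of i "next_in I A i - 1" I]
  by (simp add: level_def requirement_early)

lemma level_next_late:
  assumes "stage I + 1 \<le> next_in I A i"
  shows "level I A J i = first_dem I (stage I)
    + max_over J (\<lambda>\<tau>. \<Sum>t=stage I + 1..next_in I A i - 1. sdem I \<tau> t)"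
  using assms first_dem_late[of I "next_in I A i - 1"]
  by (simp add: level_def requirement_def second_dem_def[abs_def])

lemma level_late:
  assumes "stage I + 1 \<le> i" "i \<le> horizon I"
  shows "level I A J i = first_dem I (stage I)
    + max_over J (\<lambda>\<tau>. \<Sum>t=stage I + 1..next_in I A i - 1. sdem I \<tau> t)"
  using next_in_props(1)[OF assms(2), of A] assms(1) by (intro level_next_late) simp

lemma sinv_least_plan:
  assumes "j \<in> J" "stage I \<le> i"
  shows "sinv I (least_plan I A J) j i
    = level I A J i - first_dem I (stage I) - second_dem I j i"
  using assms by (auto simp: sinv_def least_plan_def second_dem_early)

text \<open>The inventory \<open>s\<^sub>\<tau>\<^sub>(\<^sub>i\<^sub>-\<^sub>1\<^sub>)\<close> is the previous level minus the demand of
\<open>\<tau>\<close> up to \<open>i - 1\<close>; hence each term of the claimed maximum is the demand of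
\<open>\<tau>\<close> up to the next setup minus a number that is the same for all \<open>\<tau>\<close>, which may be
taken out of the maximum. This needs a served scenario, and a positive lot provides one:
without served scenarios the requirement does not grow in the second stage.\<close>

lemma least_plan_second_stage_lot:
  assumes J: "J \<subseteq> scenarios I" and i: "stage I + 1 \<le> i" "i \<le> horizon I"
    and pos: "0 < xx (least_plan I A J) i"
  shows "xx (least_plan I A J) i = max_over J
    (\<lambda>\<tau>. (\<Sum>t=i..next_in I A i - 1. sdem I \<tau> t) - sinv I (least_plan I A J) \<tau> (i - 1))"
proof -
  let ?P = "least_plan I A J" and ?n = "next_in I A i"
  let ?c = "first_dem I (stage I) - level I A J (i - 1)"
  note P = next_in_props[OF i(2), where A = A]
  have x: "xx ?P i = max_over J (\<lambda>\<tau>. second_dem I \<tau> (?n - 1)) + ?c"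
    using level_late[OF i, of A J] by (simp add: least_plan_def second_dem_def)
  have "J \<noteq> {}"
  proof
    assume "J = {}"
    have "first_dem I (stage I) = requirement I J (i - 1)"
      using i \<open>J = {}\<close> first_dem_late[of I "i - 1"] by (simp add: requirement_def max_over_def)
    moreover have "i \<in> A" using pos level_no_setup[of i I A J] i by (auto simp: least_plan_def)
    ultimately have "?c = 0" using level_setup[of i I A J] i by simp
    then show False using x pos \<open>J = {}\<close> by (simp add: max_over_def)
  qed
  then have "xx ?P i = max_over J (\<lambda>\<tau>. second_dem I \<tau> (?n - 1) + ?c)"
    unfolding x by (intro max_over_add_const[symmetric] finite_scenario_subset[OF J])
  also have "\<dots> = max_over J (\<lambda>\<tau>. (\<Sum>t=i..?n - 1. sdem I \<tau> t) - sinv I ?P \<tau> (i - 1))"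
  proof -
    have "second_dem I \<tau> (?n - 1) + ?c = (\<Sum>t=i..?n - 1. sdem I \<tau> t) - sinv I ?P \<tau> (i - 1)"
      if "\<tau> \<in> J" for \<tau>
      using second_dem_split[of I "i - 1" "?n - 1" \<tau>] sinv_least_plan[OF that, of I "i - 1" A] i P(1)
      by simp
    then show ?thesis by (simp add: max_over_def cong: image_cong)
  qed
  finally show ?thesis .
qed

lemma last_setup_props:
  assumes "i > 0"
  shows "last_setup S i < i"
    "\<And>k. last_setup S i < k \<Longrightarrow> k < i \<Longrightarrow> yy S k \<noteq> 1"
proof -
  let ?K = "insert 0 {k \<in> {1..i - 1}. yy S k = 1}"
  have fin: "finite ?K" by simp
  have "last_setup S i \<in> ?K" unfolding last_setup_def by (intro Max_in[OF fin]) simp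
  then show "last_setup S i < i" using assms by auto
  show "yy S k \<noteq> 1" if "last_setup S i < k" "k < i" for k
  proof
    assume "yy S k = 1"
    then have "k \<in> ?K" using that by auto
    then have "k \<le> last_setup S i" unfolding last_setup_def by (rule Max_ge[OF fin])
    then show False using that by simp
  qed
qed

lemma level_const_without_setups:
  assumes "i \<le> t" "t \<le> horizon I" "\<And>k. i < k \<Longrightarrow> k \<le> t \<Longrightarrow> k \<notin> A"
  shows "level I A J t = level I A J i"
  using assms
proof (induction t rule: dec_induct)
  case (step n)
  then have "level I A J (Suc n) = level I A J n"
    using level_no_setup[of "Suc n" I A J] by simp
  then show ?case using step by simp
qed simp

text \<open>With \<open>f = i\<close> this is the one-period balance; with \<open>f = \<phi>(i)\<close> it is the balance
since the latest setup.\<close>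

lemma least_plan_inv2_balance:
  assumes "j \<in> J" "stage I + 1 \<le> f" "f \<le> i" "level I A J i = level I A J f"
  shows "inv2 (least_plan I A J) j i
    = xx (least_plan I A J) f + sinv I (least_plan I A J) j (f - 1) - (\<Sum>t=f..i. sdem I j t)"
  using assms second_dem_split[of I "f - 1" i j] sinv_least_plan[of j J I "f - 1" A]
  by (simp add: least_plan_def)

theorem proposition1:
  fixes I :: slscc
  assumes data: "slscc_data I"
    and ww1: "\<forall>i\<in>{1..stage I}. alpha I i + hold I i \<ge> alpha_ext I (i + 1)"
    and ww2: "\<forall>i\<in>{stage I + 1..horizon I - 1}.
                alpha I i + (1 - risk I) * hold I i \<ge> alpha_ext I (i + 1)"
    and terminal: "stage I < horizon I \<Longrightarrow>
                alpha I (horizon I) + (1 - risk I) * hold I (horizon I) \<ge> alpha_ext I (horizon I + 1)"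
  shows "\<exists>S. slscc_optimal I S \<and>
    \<comment> \<open>(a)\<close>
    (\<forall>i\<in>{1..horizon I}. xx S i > 0 \<longrightarrow>
       (next_setup I S i \<le> stage I \<longrightarrow>
          xx S i = (\<Sum>t=i..next_setup I S i - 1. dem I t)) \<and>
       (i \<le> stage I \<and> next_setup I S i \<ge> stage I + 1 \<longrightarrow>
          xx S i = (\<Sum>t=i..stage I. dem I t)
            + max_served I S (\<lambda>\<tau>. \<Sum>t=stage I + 1..next_setup I S i - 1. sdem I \<tau> t)) \<and>
       (i \<ge> stage I + 1 \<longrightarrow>
          xx S i = max_served I S
            (\<lambda>\<tau>. (\<Sum>t=i..next_setup I S i - 1. sdem I \<tau> t) - sinv I S \<tau> (i - 1)))) \<and>
    \<comment> \<open>(b)\<close>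
    (\<forall>i\<in>{1..stage I}.
       (next_setup I S i \<le> stage I \<longrightarrow>
          inv1 S i = (\<Sum>t=i + 1..next_setup I S i - 1. dem I t)) \<and>
       (next_setup I S i \<ge> stage I + 1 \<longrightarrow>
          inv1 S i = (\<Sum>t=i + 1..stage I. dem I t)
            + max_served I S (\<lambda>\<tau>. \<Sum>t=stage I + 1..next_setup I S i - 1. sdem I \<tau> t))) \<and>
    \<comment> \<open>(c)\<close>
    (\<forall>j\<in>scenarios I. zz S j = 0 \<longrightarrow> (\<forall>i\<in>{stage I + 1..horizon I}.
       (last_setup S i \<le> stage I \<longrightarrow>
          inv2 S j i =
            max_served I S (\<lambda>\<tau>. \<Sum>t=stage I + 1..next_setup I S i - 1. sdem I \<tau> t)
            - (\<Sum>t=stage I + 1..i. sdem I j t)) \<and>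
       (yy S i = 1 \<longrightarrow>
          inv2 S j i = xx S i + sinv I S j (i - 1) - sdem I j i) \<and>
       (yy S i = 0 \<and> last_setup S i \<ge> stage I + 1 \<longrightarrow>
          inv2 S j i = xx S (last_setup S i) + sinv I S j (last_setup S i - 1)
            - (\<Sum>t=last_setup S i..i. sdem I j t)))) \<and>
    \<comment> \<open>(d)\<close>
    (\<forall>j\<in>scenarios I. zz S j = 1 \<longrightarrow> (\<forall>i\<in>{stage I + 1..horizon I}. inv2 S j i = 0))"
proof -
  have ww: "wagner_whitin I"
    unfolding wagner_whitin_def
  proof (intro conjI ballI)
    fix i assume i: "i \<in> {stage I + 1..horizon I}"
    show "alpha_ext I (i + 1) \<le> alpha I i + (1 - risk I) * hold I i"
    proof (cases "i = horizon I")
      case True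
      then show ?thesis using terminal i by auto
    next
      case False
      then show ?thesis using ww2 i by auto
    qed
  qed (use ww1 in auto)
  obtain A J where A: "A \<subseteq> {1..horizon I}" and J: "J \<subseteq> scenarios I"
    and start: "level I A J 0 = 0" and opt: "slscc_optimal I (least_plan I A J)"
    using optimal_least_plan_exists[OF data ww] .
  let ?S = "least_plan I A J" and ?p = "stage I" and ?T = "horizon I"
  have next_eq: "next_setup I ?S i = next_in I A i" for i
    by (simp add: next_setup_eq_next_in setups_least_plan[OF A])
  have max_eq: "max_served I ?S f = max_over J f" for f
    by (simp add: max_served_eq_max_over served_least_plan[OF J])
  have p: "?p \<le> ?T" using data by (simp add: slscc_data_def)

  \<comment> \<open>A positive lot shows that the period is set up, so the preceding level is the bare
    requirement: stock is zero when a first-stage lot is produced.\<close>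
  have lot_early: "xx ?S i = level I A J i - first_dem I (i - 1)"
    if i: "i \<in> {1..?p}" and pos: "0 < xx ?S i" for i
  proof -
    have "i \<in> {1..?T}" using i p by simp
    moreover from this have "i \<in> A" using pos level_no_setup[of i I A J]
      by (auto simp: least_plan_def)
    ultimately show ?thesis using level_setup[of i I A J] i
      by (simp add: least_plan_def requirement_early)
  qed

  have a1: "xx ?S i = (\<Sum>t=i..next_in I A i - 1. dem I t)"
    if i: "i \<in> {1..?T}" and pos: "0 < xx ?S i" and n: "next_in I A i \<le> ?p" for i
  proof -
    have "i < next_in I A i" using i by (intro next_in_props) simp
    then show ?thesis
      using lot_early[OF _ pos] first_dem_split[of "i - 1" "next_in I A i - 1" I] i n
      by (simp add: level_def requirement_early)
  qed
  have a2: "xx ?S i = (\<Sum>t=i..?p. dem I t)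
      + max_over J (\<lambda>\<tau>. \<Sum>t=?p + 1..next_in I A i - 1. sdem I \<tau> t)"
    if i: "i \<in> {1..?p}" and pos: "0 < xx ?S i" and n: "?p + 1 \<le> next_in I A i" for i
  proof -
    have "i - 1 \<le> ?p" using i by auto
    then show ?thesis
      using lot_early[OF i pos] level_next_late[OF n, of J] first_dem_split[of "i - 1" ?p I] i
      by simp
  qed
  have a3: "xx ?S i = max_over J
      (\<lambda>\<tau>. (\<Sum>t=i..next_in I A i - 1. sdem I \<tau> t) - sinv I ?S \<tau> (i - 1))"
    if "i \<in> {1..?T}" "0 < xx ?S i" "?p + 1 \<le> i" for i
    using least_plan_second_stage_lot[OF J that(3) _ that(2)] that(1) by simp

  have b1: "inv1 ?S i = (\<Sum>t=i + 1..next_in I A i - 1. dem I t)"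
    if "i \<in> {1..?p}" "next_in I A i \<le> ?p" for i
    using level_next_early[OF _ that(2), of J] that(1) p by (simp add: least_plan_def)
  have b2: "inv1 ?S i = (\<Sum>t=i + 1..?p. dem I t)
      + max_over J (\<lambda>\<tau>. \<Sum>t=?p + 1..next_in I A i - 1. sdem I \<tau> t)"
    if "i \<in> {1..?p}" "?p + 1 \<le> next_in I A i" for i
    using level_next_late[OF that(2), of J] first_dem_split[of i ?p I] that(1)
    by (simp add: least_plan_def)

  have c1: "inv2 ?S j i = max_over J (\<lambda>\<tau>. \<Sum>t=?p + 1..next_in I A i - 1. sdem I \<tau> t)
      - (\<Sum>t=?p + 1..i. sdem I j t)" if "j \<in> J" "i \<in> {?p + 1..?T}" for i j
    using level_late[of I i A J] that by (simp add: least_plan_def second_dem_def)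
  have c2: "inv2 ?S j i = xx ?S i + sinv I ?S j (i - 1) - sdem I j i"
    if "j \<in> J" "i \<in> {?p + 1..?T}" for i j
    using least_plan_inv2_balance[OF that(1), of I i i A] that(2) by simp
  have c3: "inv2 ?S j i = xx ?S (last_setup ?S i) + sinv I ?S j (last_setup ?S i - 1)
      - (\<Sum>t=last_setup ?S i..i. sdem I j t)"
    if j: "j \<in> J" and i: "i \<in> {?p + 1..?T}" and y: "yy ?S i = 0"
      and f: "?p + 1 \<le> last_setup ?S i" for i j
  proof (rule least_plan_inv2_balance[OF j f])
    have "0 < i" using i by simp
    note L = last_setup_props[OF this, of ?S]
    show le: "last_setup ?S i \<le> i" using L(1) by simp
    have "k \<notin> A" if "last_setup ?S i < k" "k \<le> i" for k
      using L(2)[OF that(1)] that(2) y by (cases "k = i") (auto simp: least_plan_def)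
    then show "level I A J i = level I A J (last_setup ?S i)"
      using i by (intro level_const_without_setups[OF le]) auto
  qed

  have z: "zz ?S j = 0 \<longleftrightarrow> j \<in> J" "zz ?S j = 1 \<longleftrightarrow> j \<notin> J" for j
    by (simp_all add: least_plan_def)
  have d: "inv2 ?S j i = 0" if "j \<notin> J" for i j
    using that by (simp add: least_plan_def)

  show ?thesis
    apply (rule exI[of _ ?S])
    unfolding next_eq max_eq z
    by (intro conjI ballI impI opt a1 a2 a3 b1 b2 c1 c2 c3 d) auto
qed

end
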